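(* Let $V$ and $W$ be absolute matrix order unit spaces satisfying condition (T), and let $\phi:V\to W$ be a completely $|\cdot|$-preserving map such that $\phi(e_V)\in\mathcal{OP}(W)$, where $e_V$ is the order unit of $V$. Then $\phi$ maps $\mathcal{OP}_\infty(V)$ into $\mathcal{OP}_\infty(W)$ and there exists a unique group homomorphism $K_0(\phi):K_0(V)\to K_0(W)$ such that $$K_0(\phi)\circ\chi_V=\chi_W\circ\phi\quad\text{on }\mathcal{OP}_\infty(V),$$ where $\chi_V:\mathcal{OP}_\infty(V)\to K_0(V)$ is $\chi_V(p)=[(p,0)]$ and $\chi_W$ is defined similarly.
   Context: **Absolute matrix order unit spaces.** $M_{m,n}(V)$ denotes $m\times n$ matrices over $V$, $M_{m,n}=M_{m,n}(\mathbb C)$ with operator norm, $v\oplus w$ is the block diagonal matrix, $0_n$ the zero of $M_n(V)$. A matrix ordered space is a complex vector space $V$ with involution (with $[v_{ij}]^*=[v_{ji}^*]$ on matrices) and cones $M_n(V)^+\subset M_n(V)_{sa}$ such that each $(M_n(V)_{sa},M_n(V)^+)$ is a real ordered vector space and $a^*va\in M_m(V)^+$ for $v\in M_n(V)^+$, $a\in M_{n,m}$. It is a matrix order unit space with order unit $e\in V^+$ if $e$ is an order unit for $V_{sa}$, $V^+$ is proper and every $M_n(V)^+$ is Archimedean (if $u\in M_n(V)^+$, $v\in M_n(V)_{sa}$ and $ku+v\in M_n(V)^+$ for all $k>0$, then $v\in M_n(V)^+$). Put $e^n=e\oplus\cdots\oplus e\in M_n(V)$ and $\|v\|_n=\inf\left\{k>0:\begin{bmatrix}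 ke^n & v \\ v^* & ke^n \end{bmatrix}\in M_{2n}(V)^+\right\}$. An absolutely ordered space $(X,X^+,|\cdot|)$ is a real ordered vector space with $|\cdot|:X\to X^+$ such that: $|v|=v$ for $v\in X^+$; $|v|\pm v\in X^+$; $|kv|=|k||v|$ for $k\in\mathbb R$; if $|u-v|=u+v$ and $0\le w\le v$ then $|u-w|=u+w$; if $|u-v|=u+v$ and $|u-w|=u+w$ then $\big|u-|v\pm w|\big|=u+|v\pm w|$. For $u,v\in X^+$ write $u\perp v$ if $|u-v|=u+v$. An absolute matrix order unit space is a matrix order unit space $(V,\{M_n(V)^+\},e)$ with maps $|\cdot|_{m,n}:M_{m,n}(V)\to M_n(V)^+$ ($|\cdot|_n:=|\cdot|_{n,n}$) such that: (1) each $(M_n(V)_{sa},M_n(V)^+,|\cdot|_n)$ is an absolutely ordered space; (2) $|\alpha v\beta|_{r,s}\le\|\alpha\|\,\big||v|_{m,n}\beta\big|_{n,s}$ for $v\in M_{m,n}(V)$, $\alpha\in M_{r,m}$, $\beta\in M_{n,s}$; (3) $|v\oplus w|_{m+r,n+s}=|v|_{m,n}\oplus|w|_{r,s}$; (4) $\perp=\perp^a_\infty$ on each $M_n(V)^+$, where $u\perp_\infty v$ means $\|k_1u+k_2v\|_n=\max\{\|k_1u\|_n,\|k_2v\|_n\}$ for all $k_1,k_2\in\mathbb R$, and $u\perp^a_\infty v$ means $u_1\perp_\infty v_1$ whenever $0\le u_1\le u$, $0\le v_1\le v$. **Projections and equivalence.** $p\in M_n(V)$ is an order projection if $p^*=p$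 and $|2p-e^n|_n=e^n$; $\mathcal{OP}_n(V)$ is the set of these, $\mathcal{OP}(V)=\mathcal{OP}_1(V)$, and $\mathcal{OP}_\infty(V)=\bigcup_n\mathcal{OP}_n(V)$. $v\in M_{m,n}(V)$ is a partial isometry ($v\in\mathcal{PI}_{m,n}(V)$) if $|v|_{m,n}$ and $|v^*|_{n,m}$ are order projections. For $p\in\mathcal{OP}_m(V)$, $q\in\mathcal{OP}_n(V)$, $p\sim q$ means there is $v\in\mathcal{PI}_{m,n}(V)$ with $p=|v^*|_{n,m}$ and $q=|v|_{m,n}$. For $p,q\in\mathcal{OP}_\infty(V)$, $p\approx q$ means $p\oplus r\sim q\oplus r$ for some $r\in\mathcal{OP}_\infty(V)$. **Condition (T):** if $u\in\mathcal{PI}_{m,n}(V)$, $v\in\mathcal{PI}_{l,n}(V)$ and $|u|_{m,n}=|v|_{l,n}$, then there is $w\in\mathcal{PI}_{m,l}(V)$ with $|w^*|_{l,m}=|u^*|_{n,m}$ and $|w|_{m,l}=|v^*|_{n,l}$. **$K_0(V)$** (for $V$ satisfying (T)): the abelian group of equivalence classes $[(p,q)]$ of pairs in $\mathcal{OP}_\infty(V)\times\mathcal{OP}_\infty(V)$ under $(p_1,q_1)\equiv(p_2,q_2)\iff p_1\oplus q_2\approx p_2\oplus q_1$, with $[(p_1,q_1)]+[(p_2,q_2)]=[(p_1\oplus p_2,q_1\oplus q_2)]$, identity $[(0,0)]$ and $-[(p,q)]=[(q,p)]$. **Maps.** For a linear $\phi:V\to W$, $\phi_n:M_n(V)\to M_n(W)$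 is the entrywise amplification; $\phi$ applied to an element of $M_n(V)$ means $\phi_n$. A $*$-linear map $\phi$ is completely $|\cdot|$-preserving if $|\phi_n(v)|_n=\phi_n(|v|_n)$ for all $v\in M_n(V)$, $n\in\mathbb N$. *)

theory Defs
  imports
    Complex_Main
    "HOL-Library.FuncSet"
    "HOL-Analysis.L2_Norm"
    "HOL-Algebra.Group"
    "Jordan_Normal_Form.Matrix"
begin

section \<open>Matrices over a complex vector space\<close>

text \<open>
  The matrix type of Jordan-Normal-Form carries its dimensions. It also has matrices with no rows or
  no columns, which have to be excluded: matrix sizes are positive throughout, so \<open>mats m n\<close>
  is empty if \<open>m = 0\<close> or \<open>n = 0\<close>.
\<close>

definition mats :: "nat \<Rightarrow> nat \<Rightarrow> 'a mat set" where
  "mats m n = {v \<in> carrier_mat m n. 0 < m \<and> 0 < n}"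

definition dsum :: "'a::zero mat \<Rightarrow> 'a mat \<Rightarrow> 'a mat" where
  "dsum v w =
     four_block_mat v (0\<^sub>m (dim_row v) (dim_col w)) (0\<^sub>m (dim_row w) (dim_col v)) w"

definition madj :: "('a \<Rightarrow> 'a) \<Rightarrow> 'a mat \<Rightarrow> 'a mat" where
  "madj s v = map_mat s (transpose_mat v)"

definition eucl_norm :: "complex vec \<Rightarrow> real" where
  "eucl_norm x = L2_set (\<lambda>i. cmod (vec_index x i)) {..<dim_vec x}"

definition op_norm :: "complex mat \<Rightarrow> real" where
  "op_norm \<alpha> = (SUP x\<in>{x \<in> carrier_vec (dim_col \<alpha>). eucl_norm x \<le> 1}. eucl_norm (\<alpha> *\<^sub>v x))"

section \<open>Matrix order unit spaces\<close>

text \<open>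
  The vector space is the whole type \<open>'v\<close>, with complex scalar multiplication \<open>scl\<close> and
  involution \<open>invl\<close>. \<open>cone n\<close> is the cone of \<open>n \<times> n\<close> matrices. As matrices of
  different sizes are different, the single function \<open>mabs\<close> represents the whole family of
  absolute values on the spaces of \<open>m \<times> n\<close> matrices. Elements of the space
  are identified with \<open>1 \<times> 1\<close> matrices.
\<close>

record 'v amou =
  scl :: "complex \<Rightarrow> 'v \<Rightarrow> 'v"
  invl :: "'v \<Rightarrow> 'v"
  cone :: "nat \<Rightarrow> 'v mat set"
  ounit :: 'v
  mabs :: "'v mat \<Rightarrow> 'v mat"

definition mat1 :: "'v \<Rightarrow> 'v mat" where
  "mat1 x = mat 1 1 (\<lambda>_. x)"

definition smult :: "'v amou \<Rightarrow> complex \<Rightarrow> 'v mat \<Rightarrow> 'v mat" where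
  "smult V c v = map_mat (scl V c) v"

definition rsmult :: "'v amou \<Rightarrow> real \<Rightarrow> 'v mat \<Rightarrow> 'v mat" where
  "rsmult V k v = smult V (of_real k) v"

definition lmul :: "'v::ab_group_add amou \<Rightarrow> complex mat \<Rightarrow> 'v mat \<Rightarrow> 'v mat" where
  "lmul V \<alpha> v =
     mat (dim_row \<alpha>) (dim_col v) (\<lambda>(i, j). \<Sum>k<dim_row v. scl V (\<alpha> $$ (i, k)) (v $$ (k, j)))"

definition rmul :: "'v::ab_group_add amou \<Rightarrow> 'v mat \<Rightarrow> complex mat \<Rightarrow> 'v mat" where
  "rmul V v \<beta> =
     mat (dim_row v) (dim_col \<beta>) (\<lambda>(i, j). \<Sum>k<dim_col v. scl V (\<beta> $$ (k, j)) (v $$ (i, k)))"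

definition mstar :: "'v amou \<Rightarrow> 'v mat \<Rightarrow> 'v mat" where
  "mstar V = madj (invl V)"

definition msa :: "'v amou \<Rightarrow> nat \<Rightarrow> 'v mat set" where
  "msa V n = {v \<in> mats n n. mstar V v = v}"

definition mle :: "'v::ab_group_add amou \<Rightarrow> nat \<Rightarrow> 'v mat \<Rightarrow> 'v mat \<Rightarrow> bool" where
  "mle V n u v \<longleftrightarrow> u \<in> msa V n \<and> v \<in> msa V n \<and> v - u \<in> cone V n"

definition unitn :: "'v::ab_group_add amou \<Rightarrow> nat \<Rightarrow> 'v mat" where
  "unitn V n = mat n n (\<lambda>(i, j). if i = j then ounit V else 0)"

definition mnorm :: "'v::ab_group_add amou \<Rightarrow> nat \<Rightarrow> 'v mat \<Rightarrow> real" where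
  "mnorm V n v =
     Inf {k. 0 < k \<and>
             four_block_mat (rsmult V k (unitn V n)) v
                            (mstar V v) (rsmult V k (unitn V n)) \<in> cone V (2 * n)}"

locale matrix_ordered_space = vector_space "scl V"
  for V :: "'v::ab_group_add amou" +
  assumes invl_invl: "invl V (invl V x) = x"
    and invl_add: "invl V (x + y) = invl V x + invl V y"
    and invl_scl: "invl V (scl V c x) = scl V (cnj c) (invl V x)"
    and cone_sa: "cone V n \<subseteq> msa V n"
    and cone_zero: "0 < n \<Longrightarrow> 0\<^sub>m n n \<in> cone V n"
    and cone_add: "\<lbrakk>u \<in> cone V n; v \<in> cone V n\<rbrakk> \<Longrightarrow> u + v \<in> cone V n"
    and cone_scale: "\<lbrakk>v \<in> cone V n; 0 \<le> k\<rbrakk> \<Longrightarrow> rsmult V k v \<in> cone V n"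
    and cone_conj:
      "\<lbrakk>v \<in> cone V n; a \<in> mats n m\<rbrakk> \<Longrightarrow> rmul V (lmul V (madj cnj a) v) a \<in> cone V m"

locale matrix_order_unit_space = matrix_ordered_space V
  for V :: "'v::ab_group_add amou" +
  assumes ounit_pos: "mat1 (ounit V) \<in> cone V 1"
    and ounit_order_unit:
      "v \<in> msa V 1 \<Longrightarrow>
         \<exists>k>0. rsmult V k (mat1 (ounit V)) + v \<in> cone V 1 \<and>
               rsmult V k (mat1 (ounit V)) - v \<in> cone V 1"
    and cone_proper: "\<lbrakk>v \<in> cone V 1; - v \<in> cone V 1\<rbrakk> \<Longrightarrow> v = 0\<^sub>m 1 1"
    and archimedean:
      "\<lbrakk>u \<in> cone V n; v \<in> msa V n; \<forall>k>0. rsmult V k u + v \<in> cone V n\<rbrakk> \<Longrightarrow> v \<in> cone V n"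

section \<open>Absolute matrix order unit spaces\<close>

text \<open>
  The axioms of an absolutely ordered space for the self-adjoint \<open>n \<times> n\<close> matrices. In a matrix
  ordered space these form a real vector space ordered by \<open>cone V n\<close>.
\<close>

definition absolutely_ordered :: "'v::ab_group_add amou \<Rightarrow> nat \<Rightarrow> bool" where
  "absolutely_ordered V n \<longleftrightarrow>
     (\<forall>v\<in>msa V n. mabs V v \<in> cone V n) \<and>
     (\<forall>v\<in>cone V n. mabs V v = v) \<and>
     (\<forall>v\<in>msa V n. mabs V v + v \<in> cone V n \<and> mabs V v - v \<in> cone V n) \<and>
     (\<forall>v\<in>msa V n. \<forall>k. mabs V (rsmult V k v) = rsmult V \<bar>k\<bar> (mabs V v)) \<and>
     (\<forall>u\<in>msa V n. \<forall>v\<in>msa V n. \<forall>w\<in>msa V n.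
        mabs V (u - v) = u + v \<longrightarrow> mle V n (0\<^sub>m n n) w \<longrightarrow> mle V n w v \<longrightarrow>
        mabs V (u - w) = u + w) \<and>
     (\<forall>u\<in>msa V n. \<forall>v\<in>msa V n. \<forall>w\<in>msa V n.
        mabs V (u - v) = u + v \<longrightarrow> mabs V (u - w) = u + w \<longrightarrow>
        mabs V (u - mabs V (v + w)) = u + mabs V (v + w) \<and>
        mabs V (u - mabs V (v - w)) = u + mabs V (v - w))"

definition orth :: "'v::ab_group_add amou \<Rightarrow> 'v mat \<Rightarrow> 'v mat \<Rightarrow> bool" where
  "orth V u v \<longleftrightarrow> mabs V (u - v) = u + v"

definition orth_inf :: "'v::ab_group_add amou \<Rightarrow> nat \<Rightarrow> 'v mat \<Rightarrow> 'v mat \<Rightarrow> bool" where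
  "orth_inf V n u v \<longleftrightarrow>
     (\<forall>k1 k2. mnorm V n (rsmult V k1 u + rsmult V k2 v) =
              max (mnorm V n (rsmult V k1 u)) (mnorm V n (rsmult V k2 v)))"

definition abs_orth_inf :: "'v::ab_group_add amou \<Rightarrow> nat \<Rightarrow> 'v mat \<Rightarrow> 'v mat \<Rightarrow> bool" where
  "abs_orth_inf V n u v \<longleftrightarrow>
     (\<forall>u1 v1. mle V n (0\<^sub>m n n) u1 \<longrightarrow> mle V n u1 u \<longrightarrow>
              mle V n (0\<^sub>m n n) v1 \<longrightarrow> mle V n v1 v \<longrightarrow> orth_inf V n u1 v1)"

locale absolute_matrix_order_unit_space = matrix_order_unit_space V
  for V :: "'v::ab_group_add amou" +
  assumes mabs_pos: "v \<in> mats m n \<Longrightarrow> mabs V v \<in> cone V n"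
    and mabs_absolutely_ordered: "0 < n \<Longrightarrow> absolutely_ordered V n"
    and mabs_mul:
      "\<lbrakk>v \<in> mats m n; \<alpha> \<in> mats r m; \<beta> \<in> mats n s\<rbrakk> \<Longrightarrow>
         mle V s (mabs V (rmul V (lmul V \<alpha> v) \<beta>))
                 (rsmult V (op_norm \<alpha>) (mabs V (rmul V (mabs V v) \<beta>)))"
    and mabs_dsum:
      "\<lbrakk>v \<in> mats m n; w \<in> mats r s\<rbrakk> \<Longrightarrow> mabs V (dsum v w) = dsum (mabs V v) (mabs V w)"
    and orth_iff_abs_orth_inf:
      "\<lbrakk>u \<in> cone V n; v \<in> cone V n\<rbrakk> \<Longrightarrow> orth V u v \<longleftrightarrow> abs_orth_inf V n u v"

section \<open>Order projections, partial isometries and the Grothendieck group\<close>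

definition OP :: "'v::ab_group_add amou \<Rightarrow> nat \<Rightarrow> 'v mat set" where
  "OP V n = {p \<in> mats n n. mstar V p = p \<and> mabs V (smult V 2 p - unitn V n) = unitn V n}"

definition OPinf :: "'v::ab_group_add amou \<Rightarrow> 'v mat set" where
  "OPinf V = (\<Union>n. OP V n)"

definition PI :: "'v::ab_group_add amou \<Rightarrow> nat \<Rightarrow> nat \<Rightarrow> 'v mat set" where
  "PI V m n = {v \<in> mats m n. mabs V v \<in> OP V n \<and> mabs V (mstar V v) \<in> OP V m}"

definition op_equiv :: "'v::ab_group_add amou \<Rightarrow> 'v mat \<Rightarrow> 'v mat \<Rightarrow> bool" where
  "op_equiv V p q \<longleftrightarrow>
     (\<exists>m n. p \<in> OP V m \<and> q \<in> OP V n \<and>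
            (\<exists>v\<in>PI V m n. p = mabs V (mstar V v) \<and> q = mabs V v))"

definition op_stable_equiv :: "'v::ab_group_add amou \<Rightarrow> 'v mat \<Rightarrow> 'v mat \<Rightarrow> bool" where
  "op_stable_equiv V p q \<longleftrightarrow>
     p \<in> OPinf V \<and> q \<in> OPinf V \<and> (\<exists>r\<in>OPinf V. op_equiv V (dsum p r) (dsum q r))"

definition condition_T :: "'v::ab_group_add amou \<Rightarrow> bool" where
  "condition_T V \<longleftrightarrow>
     (\<forall>l m n. \<forall>u\<in>PI V m n. \<forall>v\<in>PI V l n. mabs V u = mabs V v \<longrightarrow>
        (\<exists>w\<in>PI V m l. mabs V (mstar V w) = mabs V (mstar V u) \<and>
                      mabs V w = mabs V (mstar V v)))"

definition K0_rel ::
    "'v::ab_group_add amou \<Rightarrow> (('v mat \<times> 'v mat) \<times> ('v mat \<times> 'v mat)) set" where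
  "K0_rel V =
     {((p1, q1), (p2, q2)) | p1 q1 p2 q2.
        p1 \<in> OPinf V \<and> q1 \<in> OPinf V \<and> p2 \<in> OPinf V \<and> q2 \<in> OPinf V \<and>
        op_stable_equiv V (dsum p1 q2) (dsum p2 q1)}"

definition K0_class :: "'v::ab_group_add amou \<Rightarrow> 'v mat \<Rightarrow> 'v mat \<Rightarrow> ('v mat \<times> 'v mat) set" where
  "K0_class V p q = K0_rel V `` {(p, q)}"

text \<open>
  The group is abelian but is written multiplicatively here, as in HOL-Algebra. The zero
  projection is represented by the \<open>1 \<times> 1\<close> zero matrix.
\<close>

definition K0 :: "'v::ab_group_add amou \<Rightarrow> ('v mat \<times> 'v mat) set monoid" where
  "K0 V =
     \<lparr>carrier = (OPinf V \<times> OPinf V) // K0_rel V,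
      mult = (\<lambda>A B. \<Union>(p1, q1)\<in>A. \<Union>(p2, q2)\<in>B. K0_class V (dsum p1 p2) (dsum q1 q2)),
      one = K0_class V (0\<^sub>m 1 1) (0\<^sub>m 1 1)\<rparr>"

definition chi :: "'v::ab_group_add amou \<Rightarrow> 'v mat \<Rightarrow> ('v mat \<times> 'v mat) set" where
  "chi V p = K0_class V p (0\<^sub>m 1 1)"

section \<open>Maps\<close>

definition star_linear ::
    "'v::ab_group_add amou \<Rightarrow> 'w::ab_group_add amou \<Rightarrow> ('v \<Rightarrow> 'w) \<Rightarrow> bool" where
  "star_linear V W \<phi> \<longleftrightarrow>
     Vector_Spaces.linear (scl V) (scl W) \<phi> \<and> (\<forall>x. \<phi> (invl V x) = invl W (\<phi> x))"

definition completely_abs_preserving ::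
    "'v::ab_group_add amou \<Rightarrow> 'w::ab_group_add amou \<Rightarrow> ('v \<Rightarrow> 'w) \<Rightarrow> bool" where
  "completely_abs_preserving V W \<phi> \<longleftrightarrow>
     star_linear V W \<phi> \<and>
     (\<forall>n. \<forall>v\<in>mats n n. mabs W (map_mat \<phi> v) = map_mat \<phi> (mabs V v))"

end

theory Submission
  imports Defs
begin

text \<open>
  The image \<open>p'\<close> of a projection satisfies \<open>|p' - (f - p')| = f\<close>, where the image \<open>f\<close> of
  the unit is itself a projection; the axioms for orthogonality turn this into
  \<open>|p' - (e - p')| = e\<close>. Partial isometries are preserved as well, hence so are the two
  equivalence relations on projections, and \<open>(p, q) \<mapsto> (\<phi> p, \<phi> q)\<close> descends to \<open>K\<^sub>0\<close>. That \<open>K\<^sub>0\<close> is an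
  abelian group, and that \<open>chi\<close> generates it, rests on \<open>p \<oplus> q \<sim> q \<oplus> p\<close>. This
  holds because the block matrix with rows \<open>(0, p)\<close> and \<open>(q, 0)\<close> arises from \<open>q \<oplus> p\<close> by permuting
  rows, and such a permutation, being an isometry with isometric inverse, preserves absolute values.
\<close>

section \<open>Block matrices\<close>

lemma mats_iff: "v \<in> mats m n \<longleftrightarrow> dim_row v = m \<and> dim_col v = n \<and> 0 < m \<and> 0 < n"
  by (auto simp: mats_def)

lemma dim_dsum [simp]:
  "dim_row (dsum v w) = dim_row v + dim_row w"
  "dim_col (dsum v w) = dim_col v + dim_col w"
  by (simp_all add: dsum_def)

lemma index_dsum:
  assumes "i < dim_row v + dim_row w" "j < dim_col v + dim_col w"
  shows "dsum v w $$ (i, j) =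
    (if i < dim_row v then if j < dim_col v then v $$ (i, j) else 0
     else if j < dim_col v then 0 else w $$ (i - dim_row v, j - dim_col v))"
  using assms by (simp add: dsum_def)

lemma dsum_mats: "v \<in> mats m n \<Longrightarrow> w \<in> mats r s \<Longrightarrow> dsum v w \<in> mats (m + r) (n + s)"
  by (simp add: mats_iff)

lemma dsum_assoc: "dsum (dsum u v) w = dsum u (dsum v w)"
proof (rule eq_matI)
  \<comment> \<open>The three alternatives name the block containing an index. Each spells out all
    the comparisons met when \<open>index_dsum\<close> is unfolded on either bracketing, so none is
    left to decide afterwards.\<close>
  have split: "k < a \<or> \<not> k < a \<and> k < a + b \<and> k - a < b \<or>
      \<not> k < a \<and> \<not> k < a + b \<and> \<not> k - a < b \<and> k - a < b + c"
    if "k < a + (b + c)" for k a b c :: nat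
    using that by arith
  fix i j assume "i < dim_row (dsum u (dsum v w))" "j < dim_col (dsum u (dsum v w))"
  then have "i < dim_row u + (dim_row v + dim_row w)" "j < dim_col u + (dim_col v + dim_col w)"
    by auto
  with split[OF this(1)] split[OF this(2)]
  show "dsum (dsum u v) w $$ (i, j) = dsum u (dsum v w) $$ (i, j)"
    by (elim disjE conjE) (simp_all add: index_dsum)
qed simp_all

text \<open>Used to recover an absolute value from that of a block sum. The shapes must be known to
  agree, since equal block sums could be cut at different places.\<close>

lemma dsum_left_cancel:
  assumes eq: "dsum v w = dsum v' w'"
    and "dim_row v = dim_row v'" "dim_col v = dim_col v'"
  shows "v = v'"
proof (rule eq_matI)
  fix i j assume ij: "i < dim_row v'" "j < dim_col v'"
  have "dsum v w $$ (i, j) = dsum v' w' $$ (i, j)" by (simp add: eq)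
  with ij assms(2,3) show "v $$ (i, j) = v' $$ (i, j)"
    by (simp add: index_dsum)
qed (use assms in auto)

lemma map_mat_dsum: "f 0 = 0 \<Longrightarrow> map_mat f (dsum v w) = dsum (map_mat f v) (map_mat f w)"
  by (rule eq_matI) (auto simp: index_dsum)

lemma madj_dsum: "s 0 = 0 \<Longrightarrow> madj s (dsum v w) = dsum (madj s v) (madj s w)"
  by (rule eq_matI) (auto simp: madj_def index_dsum)

section \<open>Permutation matrices\<close>

text \<open>Row \<open>i\<close> has its 1 in column \<open>\<pi> i\<close>, so multiplication from
  the left puts row \<open>\<pi> i\<close> in place \<open>i\<close>.\<close>

definition perm_mat :: "nat \<Rightarrow> (nat \<Rightarrow> nat) \<Rightarrow> complex mat" where
  "perm_mat n \<pi> = mat n n (\<lambda>(i, j). if j = \<pi> i then 1 else 0)"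

lemma perm_mat_mats: "0 < n \<Longrightarrow> perm_mat n \<pi> \<in> mats n n"
  by (simp add: perm_mat_def mats_iff)

lemma dim_perm_mat [simp]: "dim_row (perm_mat n \<pi>) = n" "dim_col (perm_mat n \<pi>) = n"
  by (simp_all add: perm_mat_def)

lemma eucl_norm_perm_mat:
  assumes \<pi>: "bij_betw \<pi> {..<n} {..<n}" and x: "x \<in> carrier_vec n"
  shows "eucl_norm (perm_mat n \<pi> *\<^sub>v x) = eucl_norm x"
proof -
  have entry: "(perm_mat n \<pi> *\<^sub>v x) $ i = x $ \<pi> i" if "i < n" for i
  proof -
    have "\<pi> i < n" using \<pi> that by (auto dest: bij_betwE)
    have "(perm_mat n \<pi> *\<^sub>v x) $ i = (\<Sum>k<n. (if k = \<pi> i then 1 else 0) * x $ k)"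
      using that x by (simp add: perm_mat_def scalar_prod_def lessThan_atLeast0)
    also have "\<dots> = (\<Sum>k<n. if k = \<pi> i then x $ k else 0)"
      by (rule sum.cong) auto
    also have "\<dots> = x $ \<pi> i" using \<open>\<pi> i < n\<close> by simp
    finally show ?thesis .
  qed
  have "(\<Sum>i<n. (cmod ((perm_mat n \<pi> *\<^sub>v x) $ i))\<^sup>2) = (\<Sum>i<n. (cmod (x $ \<pi> i))\<^sup>2)"
    by (rule sum.cong) (simp_all only: entry lessThan_iff)
  also have "\<dots> = (\<Sum>i<n. (cmod (x $ i))\<^sup>2)"
    by (rule sum.reindex_bij_betw[OF \<pi>])
  finally show ?thesis
    using x by (simp add: eucl_norm_def L2_set_def perm_mat_def)
qed

text \<open>The matrix acts isometrically, so the supremum is that of the norm over the unit ball;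
  the first unit vector, which exists because \<open>0 < n\<close>, attains it.\<close>

lemma op_norm_perm_mat:
  assumes \<pi>: "bij_betw \<pi> {..<n} {..<n}" and n: "0 < n"
  shows "op_norm (perm_mat n \<pi>) = 1"
proof -
  let ?B = "{x \<in> carrier_vec n. eucl_norm x \<le> 1}"
  have "L2_set (\<lambda>i. cmod (unit_vec n 0 $ i)) {..<n} = sqrt (\<Sum>i<n. if i = 0 then 1 else 0)"
    unfolding L2_set_def by (rule arg_cong[where f = sqrt], rule sum.cong) auto
  then have e: "eucl_norm (unit_vec n 0) = 1"
    using n by (simp add: eucl_norm_def)
  have "op_norm (perm_mat n \<pi>) = (SUP x\<in>?B. eucl_norm x)"
    unfolding op_norm_def
    by (rule SUP_cong) (auto simp: eucl_norm_perm_mat[OF \<pi>])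
  also have "\<dots> = 1"
    by (rule cSup_eq_maximum) (use e in \<open>auto intro!: image_eqI[of _ _ "unit_vec n 0"]\<close>)
  finally show ?thesis .
qed

text \<open>The inverse is the same map with \<open>m\<close> and \<open>n\<close>
  exchanged.\<close>

lemma bij_betw_rotate_blocks:
  "bij_betw (\<lambda>i. if i < m then n + i else i - m) {..<m + n} {..<m + (n::nat)}"
  by (rule bij_betw_byWitness[where f' = "\<lambda>i. if i < n then m + i else i - n"]) auto

section \<open>Order projections\<close>

context matrix_ordered_space
begin

lemma invl_zero: "invl V 0 = 0"
  using invl_add[of 0 0] by simp

lemma mstar_mats: "v \<in> mats m n \<Longrightarrow> mstar V v \<in> mats n m"
  by (simp add: mstar_def madj_def mats_iff)

lemma mstar_mstar: "mstar V (mstar V v) = v"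
  by (rule eq_matI) (auto simp: mstar_def madj_def invl_invl)

lemma mstar_dsum: "mstar V (dsum v w) = dsum (mstar V v) (mstar V w)"
  by (simp add: mstar_def madj_dsum invl_zero)

lemma cone_mats: "v \<in> cone V n \<Longrightarrow> v \<in> mats n n"
  using cone_sa by (auto simp: msa_def)

lemma invl_diff: "invl V (x - y) = invl V x - invl V y"
  using invl_add[of "x - y" y] by (simp add: eq_diff_eq)

lemma msa_diff: "u \<in> msa V n \<Longrightarrow> v \<in> msa V n \<Longrightarrow> u - v \<in> msa V n"
proof -
  assume a: "u \<in> msa V n" "v \<in> msa V n"
  then have d: "dim_row u = n" "dim_col u = n" "dim_row v = n" "dim_col v = n" "0 < n"
    by (auto simp: msa_def mats_iff)
  have "mstar V (u - v) = mstar V u - mstar V v"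
    by (rule eq_matI) (auto simp: mstar_def madj_def invl_diff d)
  with a d show ?thesis by (simp add: msa_def mats_iff)
qed

lemma rmul_one: "rmul V v (1\<^sub>m (dim_col v)) = v"
proof (rule eq_matI)
  fix i j assume ij: "i < dim_row v" "j < dim_col v"
  have "rmul V v (1\<^sub>m (dim_col v)) $$ (i, j) =
      (\<Sum>k<dim_col v. scl V (if k = j then 1 else 0) (v $$ (i, k)))"
    unfolding rmul_def using ij by simp
  also have "\<dots> = (\<Sum>k<dim_col v. if k = j then v $$ (i, k) else 0)"
    by (rule sum.cong) auto
  also have "\<dots> = v $$ (i, j)" using ij by simp
  finally show "rmul V v (1\<^sub>m (dim_col v)) $$ (i, j) = v $$ (i, j)" .
qed (auto simp: rmul_def)

lemma lmul_perm_mat: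
  assumes \<pi>: "bij_betw \<pi> {..<n} {..<n}" and v: "dim_row v = n"
  shows "lmul V (perm_mat n \<pi>) v = mat n (dim_col v) (\<lambda>(i, j). v $$ (\<pi> i, j))"
proof (rule eq_matI, goal_cases)
  case (1 i j)
  then have ij: "i < n" "j < dim_col v" by auto
  then have "\<pi> i < n" using \<pi> by (auto dest: bij_betwE)
  have "lmul V (perm_mat n \<pi>) v $$ (i, j) =
      (\<Sum>k<n. scl V (if k = \<pi> i then 1 else 0) (v $$ (k, j)))"
    unfolding lmul_def using ij v by (simp add: perm_mat_def)
  also have "\<dots> = (\<Sum>k<n. if k = \<pi> i then v $$ (k, j) else 0)"
    by (rule sum.cong) auto
  also have "\<dots> = v $$ (\<pi> i, j)" using \<open>\<pi> i < n\<close> by simp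
  finally show ?case using ij by simp
qed (auto simp: lmul_def perm_mat_def)

lemma rsmult_one: "rsmult V 1 v = v"
  by (rule eq_matI) (auto simp: rsmult_def smult_def)

end

section \<open>Units of the matrix levels\<close>

context matrix_order_unit_space
begin

lemma unitn_mats: "0 < n \<Longrightarrow> unitn V n \<in> mats n n"
  by (simp add: unitn_def mats_iff)

lemma unitn_dsum: "unitn V (m + n) = dsum (unitn V m) (unitn V n)"
  by (rule eq_matI) (auto simp: unitn_def index_dsum)

lemma unitn_one: "unitn V 1 = mat1 (ounit V)"
  by (rule eq_matI) (auto simp: unitn_def mat1_def)

lemma invl_ounit: "invl V (ounit V) = ounit V"
proof -
  have "mstar V (mat1 (ounit V)) = mat1 (ounit V)"
    using ounit_pos cone_sa by (auto simp: msa_def)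
  then have "mstar V (mat1 (ounit V)) $$ (0, 0) = mat1 (ounit V) $$ (0, 0)" by simp
  then show ?thesis by (simp add: mstar_def madj_def mat1_def)
qed

lemma unitn_msa: "0 < n \<Longrightarrow> unitn V n \<in> msa V n"
  unfolding msa_def mem_Collect_eq
  by (intro conjI unitn_mats eq_matI)
    (auto simp: mstar_def madj_def unitn_def invl_ounit invl_zero)

end

section \<open>Absolute values at each matrix size\<close>

context absolute_matrix_order_unit_space
begin

lemma mabs_of_pos: "v \<in> cone V n \<Longrightarrow> mabs V v = v"
  using mabs_absolutely_ordered[of n] cone_mats[of v n]
  by (auto simp: absolutely_ordered_def mats_iff)

lemma mabs_rsmult: "v \<in> msa V n \<Longrightarrow> mabs V (rsmult V k v) = rsmult V \<bar>k\<bar> (mabs V v)"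
  using mabs_absolutely_ordered[of n]
  by (auto simp: absolutely_ordered_def mats_iff msa_def)

lemma mabs_pm:
  assumes "v \<in> msa V n"
  shows "mabs V v + v \<in> cone V n" "mabs V v - v \<in> cone V n"
  using mabs_absolutely_ordered[of n] assms
  by (auto simp: absolutely_ordered_def mats_iff msa_def)

lemma mabs_uminus:
  assumes "v \<in> msa V n"
  shows "mabs V (- v) = mabs V v"
proof -
  have "rsmult V (- 1) v = - v"
    by (rule eq_matI) (auto simp: rsmult_def smult_def)
  then show ?thesis using mabs_rsmult[OF assms, of "- 1"] by (simp add: rsmult_one)
qed

lemma mabs_diff_commute:
  assumes u: "u \<in> msa V n" and v: "v \<in> msa V n"
  shows "mabs V (u - v) = mabs V (v - u)"
proof -
  have "- (v - u) = u - v"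
    by (rule eq_matI) (use u v in \<open>auto simp: msa_def mats_iff\<close>)
  with mabs_uminus[OF msa_diff[OF v u]] show ?thesis by simp
qed

text \<open>The type class alone admits 2-torsion; the complex scalars exclude it.\<close>

lemma add_self_eq_zero: "x + x = 0 \<Longrightarrow> x = (0::'v)"
proof -
  assume "x + x = 0"
  then have "scl V 2 x = 0"
    using scale_left_distrib[of 1 1 x] by simp
  then show "x = 0" by (simp add: scale_eq_0_iff)
qed

text \<open>Properness of the cone is an axiom at size 1. At size \<open>n\<close> it comes from the
  absolute value: if \<open>x = u - v\<close> and \<open>-x\<close> are both positive, then
  \<open>x = |x| = |-x| = -x\<close>.\<close>

lemma mle_antisym:
  assumes uv: "mle V n u v" and vu: "mle V n v u"
  shows "u = v"
proof -
  have d: "dim_row u = n" "dim_col u = n" "dim_row v = n" "dim_col v = n"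
    using uv by (auto simp: mle_def msa_def mats_iff)
  have sa: "u \<in> msa V n" "v \<in> msa V n" using uv by (auto simp: mle_def)
  have "u - v \<in> cone V n" using vu by (simp add: mle_def)
  then have "u - v = mabs V (u - v)" by (simp add: mabs_of_pos)
  also have "\<dots> = v - u"
    using uv mabs_of_pos[of "v - u" n] by (simp add: mle_def mabs_diff_commute[OF sa])
  finally have eq: "u - v = v - u" .
  show ?thesis
  proof (rule eq_matI)
    fix i j assume "i < dim_row v" "j < dim_col v"
    moreover have "(u - v) $$ (i, j) = (v - u) $$ (i, j)" by (simp add: eq)
    ultimately have "u $$ (i, j) - v $$ (i, j) = - (u $$ (i, j) - v $$ (i, j))"
      using d by simp
    then have "u $$ (i, j) - v $$ (i, j) = 0"
      by (rule add_self_eq_zero[OF iffD1[OF eq_neg_iff_add_eq_0]])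
    then show "u $$ (i, j) = v $$ (i, j)" by simp
  qed (use d in auto)
qed

text \<open>This is \<open>mabs_mul\<close> with the identity as right factor; the outer absolute
  value of \<open>|v|\<close> disappears because \<open>|v|\<close> is positive.\<close>

lemma mabs_lmul_le:
  assumes v: "v \<in> mats m n" and \<alpha>: "\<alpha> \<in> mats r m"
  shows "mle V n (mabs V (lmul V \<alpha> v)) (rsmult V (op_norm \<alpha>) (mabs V v))"
proof -
  have n: "0 < n" using v by (simp add: mats_iff)
  have "mabs V v \<in> cone V n" using v by (rule mabs_pos)
  then have "rmul V (mabs V v) (1\<^sub>m n) = mabs V v" "mabs V (mabs V v) = mabs V v"
    using rmul_one[of "mabs V v"] by (auto simp: mabs_of_pos mats_iff dest: cone_mats)
  moreover have "rmul V (lmul V \<alpha> v) (1\<^sub>m n) = lmul V \<alpha> v"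
    using rmul_one[of "lmul V \<alpha> v"] v by (simp add: lmul_def mats_iff)
  moreover have "(1\<^sub>m n :: complex mat) \<in> mats n n" using n by (simp add: mats_iff)
  ultimately show ?thesis using mabs_mul[OF v \<alpha>, of "1\<^sub>m n" n] by simp
qed

text \<open>Permuting rows is multiplication from the left by a matrix of norm 1, so it does not
  increase the absolute value. Neither does the inverse permutation, and antisymmetry of the order
  gives equality.\<close>

lemma mabs_perm_rows:
  assumes \<pi>: "bij_betw \<pi> {..<m} {..<m}" and v: "v \<in> mats m n"
  shows "mabs V (mat m n (\<lambda>(i, j). v $$ (\<pi> i, j))) = mabs V v"
proof (rule mle_antisym)
  have le: "mle V n (mabs V (mat m n (\<lambda>(i, j). v $$ (\<pi> i, j)))) (mabs V v)"
    if \<pi>: "bij_betw \<pi> {..<m} {..<m}" and v: "v \<in> mats m n" for v :: "'v mat" and \<pi>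
  proof -
    have "0 < m" using v by (simp add: mats_iff)
    then have "mle V n (mabs V (lmul V (perm_mat m \<pi>) v)) (rsmult V 1 (mabs V v))"
      using mabs_lmul_le[OF v perm_mat_mats[of m \<pi>]] op_norm_perm_mat[OF \<pi>] by simp
    moreover have "lmul V (perm_mat m \<pi>) v = mat m n (\<lambda>(i, j). v $$ (\<pi> i, j))"
      using lmul_perm_mat[OF \<pi>] v by (simp add: mats_iff)
    ultimately show ?thesis by (simp add: rsmult_one)
  qed
  show "mle V n (mabs V (mat m n (\<lambda>(i, j). v $$ (\<pi> i, j)))) (mabs V v)"
    by (rule le[OF \<pi> v])
  let ?\<rho> = "inv_into {..<m} \<pi>"
  have \<rho>: "bij_betw ?\<rho> {..<m} {..<m}" by (rule bij_betw_inv_into[OF \<pi>])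
  let ?w = "mat m n (\<lambda>(i, j). v $$ (\<pi> i, j))"
  \<comment> \<open>The inverse permutation takes the permuted matrix back to \<open>v\<close>, so
    \<open>le\<close> applied to \<open>?w\<close> is the reverse inequality.\<close>
  have "mat m n (\<lambda>(i, j). ?w $$ (?\<rho> i, j)) = v"
  proof (rule eq_matI)
    fix i j assume ij: "i < dim_row v" "j < dim_col v"
    then have "?\<rho> i < m" "\<pi> (?\<rho> i) = i"
      using v bij_betwE[OF \<rho>] bij_betw_inv_into_right[OF \<pi>, of i] by (auto simp: mats_iff)
    then show "mat m n (\<lambda>(i, j). ?w $$ (?\<rho> i, j)) $$ (i, j) = v $$ (i, j)"
      using ij v by (auto simp: mats_iff)
  qed (use v in \<open>auto simp: mats_iff\<close>)
  moreover have "?w \<in> mats m n" using v by (simp add: mats_iff)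
  ultimately show "mle V n (mabs V v) (mabs V ?w)" using le[OF \<rho>, of ?w] by simp
qed

section \<open>Order projections and their direct sums\<close>

lemma OP_mats: "p \<in> OP V n \<Longrightarrow> p \<in> mats n n"
  by (simp add: OP_def)

lemma OP_msa: "p \<in> OP V n \<Longrightarrow> p \<in> msa V n"
  by (simp add: OP_def msa_def)

text \<open>The condition \<open>|2 p - e| = e\<close> defining projections says that \<open>p\<close> is orthogonal to
  \<open>e - p\<close>.\<close>

lemma smult_two_minus: "p \<in> mats n n \<Longrightarrow> e \<in> mats n n \<Longrightarrow> smult V 2 p - e = p - (e - p)"
proof -
  have "scl V 2 x = x + x" for x
    using scale_left_distrib[of 1 1 x] by simp
  then show "p \<in> mats n n \<Longrightarrow> e \<in> mats n n \<Longrightarrow> smult V 2 p - e = p - (e - p)"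
    by (intro eq_matI) (auto simp: smult_def mats_iff)
qed

lemma cone_half:
  assumes v: "v \<in> mats n n" and "v + v \<in> cone V n"
  shows "v \<in> cone V n"
proof -
  have "rsmult V (1 / 2) (v + v) = v"
  proof (rule eq_matI)
    fix i j assume "i < dim_row v" "j < dim_col v"
    then show "rsmult V (1 / 2) (v + v) $$ (i, j) = v $$ (i, j)"
      using scale_left_distrib[of "1 / 2" "1 / 2" "v $$ (i, j)"]
      by (simp add: rsmult_def smult_def scale_right_distrib)
  qed (auto simp: rsmult_def smult_def)
  with cone_scale[OF assms(2), of "1 / 2"] show ?thesis by simp
qed

text \<open>The relative form, for \<open>p\<close> below an element \<open>f\<close> not necessarily equal to the unit, is
  what the image of a projection satisfies with \<open>f\<close> the image of the unit.\<close>

lemma relative_projection_pos: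
  assumes p: "p \<in> msa V n" and f: "f \<in> msa V n" and abs: "mabs V (p - (f - p)) = f"
  shows "p \<in> cone V n" "f - p \<in> cone V n"
proof -
  have d: "dim_row p = n" "dim_col p = n" "dim_row f = n" "dim_col f = n" "0 < n"
    using p f by (auto simp: msa_def mats_iff)
  have sa: "p - (f - p) \<in> msa V n" by (intro msa_diff p f)
  \<comment> \<open>With \<open>x = p - (f - p)\<close> and \<open>|x| = f\<close>, positivity of
    \<open>|x| + x\<close> and \<open>|x| - x\<close> is positivity of \<open>2 p\<close> and
    \<open>2 (f - p)\<close>.\<close>
  have "f + (p - (f - p)) = p + p" "f - (p - (f - p)) = (f - p) + (f - p)"
    by (rule eq_matI; simp add: d)+
  with mabs_pm[OF sa] abs have "p + p \<in> cone V n" "(f - p) + (f - p) \<in> cone V n" by auto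
  with d show "p \<in> cone V n" "f - p \<in> cone V n"
    by (auto intro!: cone_half simp: mats_iff)
qed

lemma OP_relative:
  assumes "p \<in> OP V n"
  shows "mabs V (p - (unitn V n - p)) = unitn V n"
  using assms smult_two_minus[of p n "unitn V n"] unitn_mats[of n]
  by (auto simp: OP_def mats_iff)

lemma OP_pos: "p \<in> OP V n \<Longrightarrow> p \<in> cone V n"
  using relative_projection_pos(1)[OF OP_msa unitn_msa OP_relative]
  by (auto simp: OP_def mats_iff)

lemma mabs_OP: "p \<in> OP V n \<Longrightarrow> mabs V p = p"
  by (rule mabs_of_pos[OF OP_pos])

text \<open>Here \<open>p\<close> is orthogonal to \<open>f - p\<close> by hypothesis and to \<open>e - f\<close> because
  \<open>p \<le> f\<close>, hence to their sum \<open>e - p\<close>.\<close>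

lemma relative_projection_OP:
  assumes p: "p \<in> msa V n" and f: "f \<in> OP V n" and abs: "mabs V (p - (f - p)) = f"
  shows "p \<in> OP V n"
proof -
  let ?e = "unitn V n"
  have fsa: "f \<in> msa V n" using f by (rule OP_msa)
  have n: "0 < n" using f by (simp add: OP_def mats_iff)
  have esa: "?e \<in> msa V n" by (rule unitn_msa[OF n])
  have d: "dim_row p = n" "dim_col p = n" "dim_row f = n" "dim_col f = n"
      "dim_row ?e = n" "dim_col ?e = n"
    using p fsa esa by (auto simp: msa_def mats_iff)
  have ao: "absolutely_ordered V n" by (rule mabs_absolutely_ordered[OF n])
  note pos = relative_projection_pos[OF p fsa abs]
  have efpos: "?e - f \<in> cone V n"
    by (rule relative_projection_pos(2)[OF fsa esa OP_relative[OF f]])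
  have z: "p - 0\<^sub>m n n = p" by (rule eq_matI) (simp_all add: d)
  have zsa: "0\<^sub>m n n \<in> msa V n" using cone_zero[OF n] cone_sa by auto
  \<comment> \<open>Prepares the axiom that orthogonality passes to smaller positive elements, with
    \<open>u = e - f\<close>, \<open>v = f\<close> and \<open>w = p\<close>.\<close>
  have "mle V n (0\<^sub>m n n) p" "mle V n p f"
    using pos p fsa zsa by (auto simp: mle_def z)
  moreover have "mabs V ((?e - f) - f) = (?e - f) + f"
  proof -
    have "(?e - f) + f = ?e" by (rule eq_matI) (simp_all add: d)
    moreover have "mabs V ((?e - f) - f) = mabs V (f - (?e - f))"
      by (rule mabs_diff_commute[OF msa_diff[OF esa fsa] fsa])
    ultimately show ?thesis by (simp add: OP_relative[OF f])
  qed
  ultimately have "mabs V ((?e - f) - p) = (?e - f) + p"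
    using ao p fsa msa_diff[OF esa fsa] unfolding absolutely_ordered_def by blast
  moreover have "(?e - f) + p = p + (?e - f)" by (rule eq_matI) (simp_all add: d)
  ultimately have 1: "mabs V (p - (?e - f)) = p + (?e - f)"
    using mabs_diff_commute[OF p msa_diff[OF esa fsa]] by simp
  have "p + (f - p) = f" by (rule eq_matI) (simp_all add: d)
  with abs have 2: "mabs V (p - (f - p)) = p + (f - p)" by simp
  have sum: "(f - p) + (?e - f) = ?e - p" by (rule eq_matI) (simp_all add: d)
  have "mabs V ((f - p) + (?e - f)) = ?e - p"
    using mabs_of_pos[OF cone_add[OF pos(2) efpos]] by (simp add: sum)
  moreover have "mabs V (p - mabs V ((f - p) + (?e - f))) = p + mabs V ((f - p) + (?e - f))"
    using ao p msa_diff[OF fsa p] msa_diff[OF esa fsa] 1 2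
    unfolding absolutely_ordered_def by blast
  moreover have "p + (?e - p) = ?e" by (rule eq_matI) (simp_all add: d)
  ultimately have "mabs V (p - (?e - p)) = ?e" by simp
  then show ?thesis
    using p smult_two_minus[of p n ?e] unitn_mats[OF n] by (simp add: OP_def msa_def)
qed

text \<open>Since the unit splits along the blocks, \<open>2 (p \<oplus> q) - e\<close> is the block
  sum of \<open>2 p - e\<close> and \<open>2 q - e\<close>, and absolute values respect block
  sums.\<close>

lemma OP_dsum:
  assumes p: "p \<in> OP V m" and q: "q \<in> OP V n"
  shows "dsum p q \<in> OP V (m + n)"
proof -
  have pq: "p \<in> mats m m" "q \<in> mats n n" using p q by (auto simp: OP_def)
  have e: "unitn V m \<in> mats m m" "unitn V n \<in> mats n n"
    using pq by (auto simp: mats_iff unitn_def)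
  have "smult V 2 (dsum p q) - dsum (unitn V m) (unitn V n)
      = dsum (smult V 2 p - unitn V m) (smult V 2 q - unitn V n)"
    by (rule eq_matI) (use pq e in \<open>auto simp: index_dsum smult_def mats_iff\<close>)
  moreover have "smult V 2 p - unitn V m \<in> mats m m" "smult V 2 q - unitn V n \<in> mats n n"
    using pq e by (auto simp: mats_iff smult_def)
  ultimately show ?thesis
    using p q by (simp add: OP_def mabs_dsum mstar_dsum unitn_dsum dsum_mats)
qed

lemma OPinf_dsum: "p \<in> OPinf V \<Longrightarrow> q \<in> OPinf V \<Longrightarrow> dsum p q \<in> OPinf V"
  by (auto simp: OPinf_def dest: OP_dsum)

text \<open>For \<open>p = 0\<close> the defining condition reads \<open>|-e| = e\<close>, which
  holds because \<open>e\<close> is positive.\<close>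

lemma zero_OPinf: "0\<^sub>m 1 1 \<in> OPinf V"
proof -
  have "(0\<^sub>m 1 1 :: 'v mat) \<in> msa V 1" using cone_zero[of 1] cone_sa by auto
  moreover have "smult V 2 (0\<^sub>m 1 1) - unitn V 1 = - unitn V 1"
    by (rule eq_matI) (auto simp: smult_def unitn_def)
  moreover have "mabs V (- unitn V 1) = unitn V 1"
    using mabs_uminus[OF unitn_msa[of 1]] mabs_of_pos[OF ounit_pos] unitn_one by simp
  ultimately show ?thesis by (auto simp: OPinf_def OP_def msa_def)
qed

section \<open>Equivalence of projections\<close>

lemma op_equivI:
  "v \<in> PI V m n \<Longrightarrow> op_equiv V (mabs V (mstar V v)) (mabs V v)"
  by (auto simp: op_equiv_def PI_def)

lemma op_equivE:
  assumes "op_equiv V p q"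
  obtains v m n where "v \<in> PI V m n" "p = mabs V (mstar V v)" "q = mabs V v"
  using assms by (auto simp: op_equiv_def)

lemma op_equiv_OPinf: "op_equiv V p q \<Longrightarrow> p \<in> OPinf V" "op_equiv V p q \<Longrightarrow> q \<in> OPinf V"
  by (auto simp: op_equiv_def OPinf_def)

lemma PI_mstar: "v \<in> PI V m n \<Longrightarrow> mstar V v \<in> PI V n m"
  by (simp add: PI_def mstar_mats mstar_mstar)

text \<open>A projection is positive and self-adjoint, so it is itself the partial isometry
  required.\<close>

lemma op_equiv_refl:
  assumes "p \<in> OPinf V"
  shows "op_equiv V p p"
proof -
  obtain n where p: "p \<in> OP V n" using assms by (auto simp: OPinf_def)
  then have abs: "mabs V p = p" "mstar V p = p"
    by (rule mabs_OP, simp add: OP_def)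
  have "p \<in> PI V n n" using p by (simp add: PI_def abs OP_mats)
  from op_equivI[OF this] show ?thesis by (simp add: abs)
qed

lemma op_equiv_sym: "op_equiv V p q \<Longrightarrow> op_equiv V q p"
  by (erule op_equivE) (metis op_equivI PI_mstar mstar_mstar)

lemma op_equiv_dsum:
  assumes "op_equiv V p p'" "op_equiv V q q'"
  shows "op_equiv V (dsum p q) (dsum p' q')"
proof -
  obtain v m n where v: "v \<in> PI V m n" "p = mabs V (mstar V v)" "p' = mabs V v"
    using assms(1) by (rule op_equivE)
  obtain w r s where w: "w \<in> PI V r s" "q = mabs V (mstar V w)" "q' = mabs V w"
    using assms(2) by (rule op_equivE)
  have vw: "v \<in> mats m n" "w \<in> mats r s" using v w by (auto simp: PI_def)
  have abs: "mabs V (dsum v w) = dsum p' q'" "mabs V (mstar V (dsum v w)) = dsum p q"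
    using mabs_dsum[OF vw] mabs_dsum[OF mstar_mats mstar_mats, OF vw] v w
    by (auto simp: mstar_dsum)
  have "dsum v w \<in> PI V (m + r) (n + s)"
    using v w unfolding PI_def abs mem_Collect_eq by (intro conjI dsum_mats OP_dsum) auto
  from op_equivI[OF this] show ?thesis by (simp add: abs)
qed

text \<open>Rows \<open>n, ..., n + m - 1\<close> of \<open>q \<oplus> p\<close> are those of
  \<open>(0, p)\<close>; moving them to the top gives the block matrix.\<close>

lemma mabs_block_swap:
  assumes p: "p \<in> OP V m" and q: "q \<in> OP V n"
  shows "mabs V (four_block_mat (0\<^sub>m m n) p q (0\<^sub>m n m)) = dsum q p"
proof -
  let ?\<pi> = "\<lambda>i. if i < m then n + i else i - m"
  have pq: "p \<in> mats m m" "q \<in> mats n n" using p q by (auto simp: OP_def)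
  have qp: "dsum q p \<in> mats (m + n) (m + n)" using pq by (simp add: mats_iff)
  have "four_block_mat (0\<^sub>m m n) p q (0\<^sub>m n m) =
      mat (m + n) (m + n) (\<lambda>(i, j). dsum q p $$ (?\<pi> i, j))"
    by (rule eq_matI) (use pq in \<open>auto simp: index_dsum mats_iff\<close>)
  then have "mabs V (four_block_mat (0\<^sub>m m n) p q (0\<^sub>m n m)) = mabs V (dsum q p)"
    using mabs_perm_rows[OF bij_betw_rotate_blocks qp] by simp
  also have "\<dots> = dsum q p" by (rule mabs_OP[OF OP_dsum[OF q p]])
  finally show ?thesis .
qed

text \<open>The block matrix with rows \<open>(0, p)\<close> and \<open>(q, 0)\<close> is the
  partial isometry. Its adjoint has the same form with \<open>p\<close> and \<open>q\<close>
  exchanged, so one computation gives both absolute values.\<close>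

lemma op_equiv_dsum_commute:
  assumes "p \<in> OPinf V" "q \<in> OPinf V"
  shows "op_equiv V (dsum p q) (dsum q p)"
proof -
  obtain m n where p: "p \<in> OP V m" and q: "q \<in> OP V n"
    using assms by (auto simp: OPinf_def)
  let ?v = "four_block_mat (0\<^sub>m m n) p q (0\<^sub>m n m)"
  have pq: "p \<in> mats m m" "q \<in> mats n n" "mstar V p = p" "mstar V q = q"
    using p q by (auto simp: OP_def)
  have pq_entry: "invl V (p $$ (j, i)) = p $$ (i, j)" if "i < m" "j < m" for i j
  proof -
    have "mstar V p $$ (i, j) = p $$ (i, j)" by (simp only: pq)
    with that pq(1,2) show ?thesis by (simp add: mstar_def madj_def mats_iff)
  qed
  have q_entry: "invl V (q $$ (j, i)) = q $$ (i, j)" if "i < n" "j < n" for i j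
  proof -
    have "mstar V q $$ (i, j) = q $$ (i, j)" by (simp only: pq)
    with that pq(1,2) show ?thesis by (simp add: mstar_def madj_def mats_iff)
  qed
  have star: "mstar V ?v = four_block_mat (0\<^sub>m n m) q p (0\<^sub>m m n)"
    by (rule eq_matI)
      (use pq in \<open>auto simp: mstar_def madj_def mats_iff invl_zero pq_entry q_entry\<close>)
  have abs: "mabs V ?v = dsum q p" "mabs V (mstar V ?v) = dsum p q"
    unfolding star by (rule mabs_block_swap; fact)+
  have "?v \<in> PI V (m + n) (n + m)"
    using pq OP_dsum[OF p q] OP_dsum[OF q p] unfolding PI_def abs mem_Collect_eq
    by (simp add: mats_iff)
  from op_equivI[OF this] show ?thesis by (simp add: abs)
qed

end

section \<open>The group \<open>K\<^sub>0\<close>\<close>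

locale absolute_matrix_order_unit_space_T = absolute_matrix_order_unit_space +
  assumes T: "condition_T V"
begin

text \<open>Condition (T) replaces a product of partial isometries. It is applied to
  \<open>u\<close> and the adjoint of \<open>v\<close>, which have the common absolute value
  \<open>q\<close>.\<close>

lemma op_equiv_trans [trans]:
  assumes "op_equiv V p q" "op_equiv V q r"
  shows "op_equiv V p r"
proof -
  obtain u m n where u: "u \<in> PI V m n" "p = mabs V (mstar V u)" "q = mabs V u"
    using assms(1) by (rule op_equivE)
  obtain v n' l where v: "v \<in> PI V n' l" "q = mabs V (mstar V v)" "r = mabs V v"
    using assms(2) by (rule op_equivE)
  have "q \<in> mats n n" "q \<in> mats n' n'"
    using u v by (auto simp: PI_def OP_def)
  then have "n' = n" by (simp add: mats_iff)
  with v have v': "mstar V v \<in> PI V l n" using PI_mstar by blast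
  have "mabs V u = mabs V (mstar V v)" using u(3) v(2) by (rule subst)
  then obtain w where w: "w \<in> PI V m l" "mabs V (mstar V w) = mabs V (mstar V u)"
      "mabs V w = mabs V (mstar V (mstar V v))"
    using T[unfolded condition_T_def, rule_format, OF u(1) v'] by auto
  show ?thesis using op_equivI[OF w(1)] unfolding w(2,3) u(2) v(3) mstar_mstar .
qed

section \<open>Stable equivalence\<close>

lemma op_stable_equivI:
  "op_equiv V (dsum p r) (dsum q r) \<Longrightarrow> p \<in> OPinf V \<Longrightarrow> q \<in> OPinf V \<Longrightarrow> r \<in> OPinf V \<Longrightarrow>
    op_stable_equiv V p q"
  unfolding op_stable_equiv_def by blast

lemma op_equiv_imp_stable:
  assumes "op_equiv V p q"
  shows "op_stable_equiv V p q"
  by (rule op_stable_equivI[OF op_equiv_dsum[OF assms op_equiv_refl[OF zero_OPinf]]])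
    (rule op_equiv_OPinf[OF assms] zero_OPinf)+

lemma op_stable_equiv_sym: "op_stable_equiv V p q \<Longrightarrow> op_stable_equiv V q p"
  unfolding op_stable_equiv_def using op_equiv_sym by fast

lemma op_equiv_dsum_right_commute:
  assumes "p \<in> OPinf V" "q \<in> OPinf V" "r \<in> OPinf V"
  shows "op_equiv V (dsum (dsum p q) r) (dsum (dsum p r) q)"
  unfolding dsum_assoc
  by (rule op_equiv_dsum[OF op_equiv_refl op_equiv_dsum_commute]; fact)

text \<open>If \<open>r\<close> and \<open>s\<close> stabilise the two equivalences,
  \<open>r \<oplus> s\<close> stabilises the composite: the summand not in use is moved to the end
  while the other equivalence is applied.\<close>

lemma op_stable_equiv_trans [trans]:
  assumes "op_stable_equiv V p q" "op_stable_equiv V q t"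
  shows "op_stable_equiv V p t"
proof -
  obtain r where r: "r \<in> OPinf V" "op_equiv V (dsum p r) (dsum q r)"
    using assms(1) unfolding op_stable_equiv_def by blast
  obtain s where s: "s \<in> OPinf V" "op_equiv V (dsum q s) (dsum t s)"
    using assms(2) unfolding op_stable_equiv_def by blast
  have P: "p \<in> OPinf V" "q \<in> OPinf V" "t \<in> OPinf V"
    using assms unfolding op_stable_equiv_def by blast+
  have "op_equiv V (dsum (dsum p r) s) (dsum (dsum q r) s)"
    by (intro op_equiv_dsum op_equiv_refl r s)
  also have "op_equiv V \<dots> (dsum (dsum q s) r)"
    by (intro op_equiv_dsum_right_commute P r s)
  also have "op_equiv V \<dots> (dsum (dsum t s) r)"
    by (intro op_equiv_dsum op_equiv_refl r s)
  also have "op_equiv V \<dots> (dsum (dsum t r) s)"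
    by (intro op_equiv_dsum_right_commute P r s)
  finally have "op_equiv V (dsum p (dsum r s)) (dsum t (dsum r s))"
    unfolding dsum_assoc .
  then show ?thesis by (rule op_stable_equivI) (intro OPinf_dsum P r s)+
qed

lemma op_stable_equiv_dsum:
  assumes "op_stable_equiv V p p'" "op_stable_equiv V q q'"
  shows "op_stable_equiv V (dsum p q) (dsum p' q')"
proof -
  obtain r where r: "r \<in> OPinf V" "op_equiv V (dsum p r) (dsum p' r)"
    using assms(1) unfolding op_stable_equiv_def by blast
  obtain s where s: "s \<in> OPinf V" "op_equiv V (dsum q s) (dsum q' s)"
    using assms(2) unfolding op_stable_equiv_def by blast
  have P: "p \<in> OPinf V" "p' \<in> OPinf V" "q \<in> OPinf V" "q' \<in> OPinf V"
    using assms unfolding op_stable_equiv_def by blast+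
  \<comment> \<open>Each stabiliser is moved next to its own projection, so that
    \<open>r \<oplus> s\<close> serves for the sum.\<close>
  have shuffle: "op_equiv V (dsum (dsum a b) (dsum r s)) (dsum (dsum a r) (dsum b s))"
    if "a \<in> OPinf V" "b \<in> OPinf V" for a b
    using op_equiv_dsum[OF op_equiv_dsum_right_commute[OF that r(1)] op_equiv_refl[OF s(1)]]
    by (simp add: dsum_assoc)
  note shuffle[OF P(1,3)]
  also have "op_equiv V (dsum (dsum p r) (dsum q s)) (dsum (dsum p' r) (dsum q' s))"
    by (intro op_equiv_dsum r s)
  also note op_equiv_sym[OF shuffle[OF P(2,4)]]
  finally show ?thesis by (rule op_stable_equivI) (intro OPinf_dsum P r s)+
qed

text \<open>The common summand \<open>s\<close> is absorbed into the stabiliser. This cancellation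
  makes the relation on pairs transitive.\<close>

lemma op_stable_equiv_cancel:
  assumes "op_stable_equiv V (dsum p s) (dsum q s)"
    and "p \<in> OPinf V" "q \<in> OPinf V" "s \<in> OPinf V"
  shows "op_stable_equiv V p q"
proof -
  obtain r where r: "r \<in> OPinf V" "op_equiv V (dsum (dsum p s) r) (dsum (dsum q s) r)"
    using assms(1) by (auto simp: op_stable_equiv_def)
  then have "op_equiv V (dsum p (dsum s r)) (dsum q (dsum s r))" by (simp add: dsum_assoc)
  then show ?thesis by (rule op_stable_equivI) (intro OPinf_dsum assms r)+
qed

lemma dsum4_swap_stable:
  assumes "a \<in> OPinf V" "b \<in> OPinf V" "c \<in> OPinf V" "d \<in> OPinf V"
  shows "op_stable_equiv V (dsum (dsum a b) (dsum c d)) (dsum (dsum a c) (dsum b d))"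
  using op_equiv_dsum[OF op_equiv_dsum_right_commute[OF assms(1-3)] op_equiv_refl[OF assms(4)]]
  by (simp add: dsum_assoc op_equiv_imp_stable)

lemma dsum_commute_stable:
  "p \<in> OPinf V \<Longrightarrow> q \<in> OPinf V \<Longrightarrow> op_stable_equiv V (dsum p q) (dsum q p)"
  by (intro op_equiv_imp_stable op_equiv_dsum_commute)

lemma dsum_commute_right_stable:
  assumes "a \<in> OPinf V" "p \<in> OPinf V" "q \<in> OPinf V"
  shows "op_stable_equiv V (dsum a (dsum p q)) (dsum a (dsum q p))"
  by (rule op_equiv_imp_stable[OF op_equiv_dsum[OF op_equiv_refl op_equiv_dsum_commute]]; fact)

section \<open>Classes of pairs and their group structure\<close>

lemma K0_rel_iff:
  "((p1, q1), (p2, q2)) \<in> K0_rel V \<longleftrightarrow>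
    p1 \<in> OPinf V \<and> q1 \<in> OPinf V \<and> p2 \<in> OPinf V \<and> q2 \<in> OPinf V \<and>
    op_stable_equiv V (dsum p1 q2) (dsum p2 q1)"
  by (auto simp: K0_rel_def)

lemma equiv_K0_rel: "equiv (OPinf V \<times> OPinf V) (K0_rel V)"
proof (rule equivI)
  show "K0_rel V \<subseteq> (OPinf V \<times> OPinf V) \<times> (OPinf V \<times> OPinf V)"
    by (auto simp: K0_rel_def)
  show "refl_on (OPinf V \<times> OPinf V) (K0_rel V)"
    by (auto simp: refl_on_def K0_rel_iff intro!: op_equiv_imp_stable op_equiv_refl OPinf_dsum)
  show "sym (K0_rel V)"
    unfolding sym_def by (clarsimp simp: K0_rel_iff op_stable_equiv_sym)
  show "trans (K0_rel V)"
  proof (rule transI, clarify)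
    fix p1 q1 p2 q2 p3 q3
    assume a: "((p1, q1), (p2, q2)) \<in> K0_rel V" and b: "((p2, q2), (p3, q3)) \<in> K0_rel V"
    then have P: "p1 \<in> OPinf V" "q1 \<in> OPinf V" "p2 \<in> OPinf V" "q2 \<in> OPinf V"
        "p3 \<in> OPinf V" "q3 \<in> OPinf V"
      by (auto simp: K0_rel_iff)
    \<comment> \<open>Adding \<open>p2 \<oplus> q2\<close> allows a rearrangement into
      \<open>(p1 \<oplus> q2) \<oplus> (p2 \<oplus> q3)\<close>, where both hypotheses apply at
      once; the added summand is cancelled at the end.\<close>
    have "op_stable_equiv V (dsum (dsum p1 q3) (dsum p2 q2)) (dsum (dsum p1 q3) (dsum q2 p2))"
      by (intro dsum_commute_right_stable OPinf_dsum P)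
    also have "op_stable_equiv V \<dots> (dsum (dsum p1 q2) (dsum q3 p2))"
      by (intro dsum4_swap_stable P)
    also have "op_stable_equiv V \<dots> (dsum (dsum p1 q2) (dsum p2 q3))"
      by (intro dsum_commute_right_stable OPinf_dsum P)
    also have "op_stable_equiv V \<dots> (dsum (dsum p2 q1) (dsum p3 q2))"
      by (rule op_stable_equiv_dsum) (use a b in \<open>simp_all add: K0_rel_iff\<close>)
    also have "op_stable_equiv V \<dots> (dsum (dsum p3 q2) (dsum p2 q1))"
      by (intro dsum_commute_stable OPinf_dsum P)
    also have "op_stable_equiv V \<dots> (dsum (dsum p3 q2) (dsum q1 p2))"
      by (intro dsum_commute_right_stable OPinf_dsum P)
    also have "op_stable_equiv V \<dots> (dsum (dsum p3 q1) (dsum q2 p2))"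
      by (intro dsum4_swap_stable P)
    also have "op_stable_equiv V \<dots> (dsum (dsum p3 q1) (dsum p2 q2))"
      by (intro dsum_commute_right_stable OPinf_dsum P)
    finally have "op_stable_equiv V (dsum p1 q3) (dsum p3 q1)"
      by (rule op_stable_equiv_cancel) (intro OPinf_dsum P)+
    with P show "((p1, q1), (p3, q3)) \<in> K0_rel V" by (simp add: K0_rel_iff)
  qed
qed

lemma K0_class_eq_iff:
  assumes "p1 \<in> OPinf V" "q1 \<in> OPinf V" "p2 \<in> OPinf V" "q2 \<in> OPinf V"
  shows "K0_class V p1 q1 = K0_class V p2 q2 \<longleftrightarrow>
    op_stable_equiv V (dsum p1 q2) (dsum p2 q1)"
  using assms eq_equiv_class_iff[OF equiv_K0_rel, of "(p1, q1)" "(p2, q2)"]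
  by (auto simp: K0_class_def K0_rel_iff)

lemma K0_class_eqI:
  assumes "op_equiv V (dsum p1 q2) (dsum p2 q1)"
    and "p1 \<in> OPinf V" "q1 \<in> OPinf V" "p2 \<in> OPinf V" "q2 \<in> OPinf V"
  shows "K0_class V p1 q1 = K0_class V p2 q2"
  using assms by (simp add: K0_class_eq_iff op_equiv_imp_stable)

lemma carrier_K0_iff:
  "A \<in> carrier (K0 V) \<longleftrightarrow> (\<exists>p\<in>OPinf V. \<exists>q\<in>OPinf V. A = K0_class V p q)"
  by (auto simp: K0_def K0_class_def quotient_def)

lemma K0_class_carrier: "p \<in> OPinf V \<Longrightarrow> q \<in> OPinf V \<Longrightarrow> K0_class V p q \<in> carrier (K0 V)"
  by (auto simp: carrier_K0_iff)

text \<open>The product is defined as a union over all representatives, so this is where its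
  independence of the representatives is proved.\<close>

lemma K0_mult:
  assumes P: "p1 \<in> OPinf V" "q1 \<in> OPinf V" "p2 \<in> OPinf V" "q2 \<in> OPinf V"
  shows "K0_class V p1 q1 \<otimes>\<^bsub>K0 V\<^esub> K0_class V p2 q2 = K0_class V (dsum p1 p2) (dsum q1 q2)"
proof -
  let ?C = "K0_class V (dsum p1 p2) (dsum q1 q2)"
  have "K0_class V (dsum a1 a2) (dsum b1 b2) = ?C"
    if "((p1, q1), (a1, b1)) \<in> K0_rel V" "((p2, q2), (a2, b2)) \<in> K0_rel V" for a1 b1 a2 b2
  proof -
    have A: "a1 \<in> OPinf V" "b1 \<in> OPinf V" "a2 \<in> OPinf V" "b2 \<in> OPinf V"
      using that by (auto simp: K0_rel_iff)
    have "op_stable_equiv V (dsum (dsum p1 p2) (dsum b1 b2)) (dsum (dsum p1 b1) (dsum p2 b2))"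
      by (intro dsum4_swap_stable P A)
    also have "op_stable_equiv V \<dots> (dsum (dsum a1 q1) (dsum a2 q2))"
      by (rule op_stable_equiv_dsum) (use that in \<open>simp_all add: K0_rel_iff\<close>)
    also have "op_stable_equiv V \<dots> (dsum (dsum a1 a2) (dsum q1 q2))"
      by (intro dsum4_swap_stable P A)
    finally show ?thesis using P A
      by (subst K0_class_eq_iff) (auto intro: OPinf_dsum op_stable_equiv_sym)
  qed
  then have const: "K0_class V (dsum a1 a2) (dsum b1 b2) = ?C"
    if "(a1, b1) \<in> K0_class V p1 q1" "(a2, b2) \<in> K0_class V p2 q2" for a1 b1 a2 b2
    using that by (simp add: K0_class_def[of V p1 q1] K0_class_def[of V p2 q2])
  have ne: "K0_class V p1 q1 \<noteq> {}" "K0_class V p2 q2 \<noteq> {}"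
    unfolding K0_class_def using P equiv_class_self[OF equiv_K0_rel] by blast+
  \<comment> \<open>By \<open>const\<close> all members of the family are the same set, and the
    index sets are nonempty, so the union is that set.\<close>
  have "(\<Union>(a1, b1)\<in>K0_class V p1 q1. \<Union>(a2, b2)\<in>K0_class V p2 q2.
      K0_class V (dsum a1 a2) (dsum b1 b2)) = ?C"
    by (rule SUP_eq_const[OF ne(1)], simp only: split_paired_all prod.case,
        rule SUP_eq_const[OF ne(2)], simp only: split_paired_all prod.case, rule const)
  then show ?thesis by (simp add: K0_def)
qed

lemma K0_one: "\<one>\<^bsub>K0 V\<^esub> = K0_class V (0\<^sub>m 1 1) (0\<^sub>m 1 1)"
  by (simp add: K0_def)

lemma comm_group_K0: "comm_group (K0 V)"
proof (rule comm_groupI)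
  fix x y assume "x \<in> carrier (K0 V)" "y \<in> carrier (K0 V)"
  then show "x \<otimes>\<^bsub>K0 V\<^esub> y \<in> carrier (K0 V)"
    by (auto simp: carrier_K0_iff[of x] carrier_K0_iff[of y] K0_mult
        intro!: K0_class_carrier OPinf_dsum)
next
  show "\<one>\<^bsub>K0 V\<^esub> \<in> carrier (K0 V)"
    using zero_OPinf by (auto simp: K0_one K0_class_carrier)
next
  fix x y z
  assume "x \<in> carrier (K0 V)" "y \<in> carrier (K0 V)" "z \<in> carrier (K0 V)"
  then show "x \<otimes>\<^bsub>K0 V\<^esub> y \<otimes>\<^bsub>K0 V\<^esub> z = x \<otimes>\<^bsub>K0 V\<^esub> (y \<otimes>\<^bsub>K0 V\<^esub> z)"
    by (auto simp: carrier_K0_iff K0_mult OPinf_dsum dsum_assoc)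
next
  fix x y assume "x \<in> carrier (K0 V)" "y \<in> carrier (K0 V)"
  then obtain p q p' q' where xy: "p \<in> OPinf V" "q \<in> OPinf V" "x = K0_class V p q"
      "p' \<in> OPinf V" "q' \<in> OPinf V" "y = K0_class V p' q'"
    by (auto simp: carrier_K0_iff)
  have "op_equiv V (dsum (dsum p p') (dsum q' q)) (dsum (dsum p' p) (dsum q q'))"
    by (rule op_equiv_dsum[OF op_equiv_dsum_commute op_equiv_dsum_commute]) (rule xy)+
  then have "K0_class V (dsum p p') (dsum q q') = K0_class V (dsum p' p) (dsum q' q)"
    by (rule K0_class_eqI) (intro OPinf_dsum xy)+
  then show "x \<otimes>\<^bsub>K0 V\<^esub> y = y \<otimes>\<^bsub>K0 V\<^esub> x" by (simp add: xy K0_mult)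
next
  fix x assume "x \<in> carrier (K0 V)"
  then obtain p q where x: "p \<in> OPinf V" "q \<in> OPinf V" "x = K0_class V p q"
    by (auto simp: carrier_K0_iff)
  let ?z = "0\<^sub>m 1 1"
  \<comment> \<open>\<open>0 \<oplus> p\<close> is a larger matrix than \<open>p\<close>, so
    neutrality holds only for classes. By associativity the right-hand side is
    \<open>p \<oplus> (0 \<oplus> q)\<close>.\<close>
  have "op_equiv V (dsum (dsum ?z p) q) (dsum (dsum p ?z) q)"
    by (rule op_equiv_dsum[OF op_equiv_dsum_commute op_equiv_refl]) (rule x zero_OPinf)+
  then have "K0_class V (dsum ?z p) (dsum ?z q) = K0_class V p q"
    using x zero_OPinf by (intro K0_class_eqI) (auto simp: dsum_assoc intro!: OPinf_dsum)
  then show "\<one>\<^bsub>K0 V\<^esub> \<otimes>\<^bsub>K0 V\<^esub> x = x"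
    using K0_mult[OF zero_OPinf zero_OPinf] x by (simp add: K0_one)
  \<comment> \<open>The inverse of the class of \<open>(p, q)\<close> is that of
    \<open>(q, p)\<close>: the components of the sum are \<open>q \<oplus> p\<close> and
    \<open>p \<oplus> q\<close>.\<close>
  have "op_equiv V (dsum (dsum q p) ?z) (dsum ?z (dsum p q))"
    by (rule op_equiv_trans[OF op_equiv_dsum_commute
        op_equiv_dsum[OF op_equiv_refl op_equiv_dsum_commute]])
      (intro OPinf_dsum x zero_OPinf)+
  then have "K0_class V (dsum q p) (dsum p q) = \<one>\<^bsub>K0 V\<^esub>"
    unfolding K0_one by (rule K0_class_eqI) (intro OPinf_dsum x zero_OPinf)+
  then have "K0_class V q p \<otimes>\<^bsub>K0 V\<^esub> x = \<one>\<^bsub>K0 V\<^esub>"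
    by (simp add: x K0_mult)
  with x show "\<exists>y\<in>carrier (K0 V). y \<otimes>\<^bsub>K0 V\<^esub> x = \<one>\<^bsub>K0 V\<^esub>"
    using K0_class_carrier by blast
qed

lemma chi_carrier: "p \<in> OPinf V \<Longrightarrow> chi V p \<in> carrier (K0 V)"
  using zero_OPinf by (simp add: chi_def K0_class_carrier)

text \<open>In additive terms the class of \<open>(p, q)\<close> is
  \<open>chi V p - chi V q\<close>, so the values of \<open>chi\<close> generate the group.\<close>

lemma chi_mult_K0_class:
  assumes "p \<in> OPinf V" "q \<in> OPinf V"
  shows "K0_class V p q \<otimes>\<^bsub>K0 V\<^esub> chi V q = chi V p"
proof -
  let ?z = "0\<^sub>m 1 1"
  have "op_equiv V (dsum (dsum p q) ?z) (dsum p (dsum q ?z))"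
    unfolding dsum_assoc by (intro op_equiv_refl OPinf_dsum assms zero_OPinf)
  then show ?thesis
    using assms zero_OPinf unfolding chi_def
    by (simp only: K0_mult) (intro K0_class_eqI OPinf_dsum; assumption)
qed

text \<open>Homomorphisms that agree on generators agree on the carrier; extensionality settles the
  arguments outside it.\<close>

lemma K0_hom_eqI:
  assumes g: "group_hom (K0 V) G g" "g \<in> extensional (carrier (K0 V))"
    and h: "group_hom (K0 V) G h" "h \<in> extensional (carrier (K0 V))"
    and eq: "\<And>p. p \<in> OPinf V \<Longrightarrow> g (chi V p) = h (chi V p)"
  shows "g = h"
proof (rule extensionalityI[OF g(2) h(2)])
  interpret g: group_hom "K0 V" G g by (rule g)
  interpret h: group_hom "K0 V" G h by (rule h)
  fix x assume "x \<in> carrier (K0 V)"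
  then obtain p q where x: "p \<in> OPinf V" "q \<in> OPinf V" "x = K0_class V p q"
    by (auto simp: carrier_K0_iff)
  have c: "x \<in> carrier (K0 V)" "chi V q \<in> carrier (K0 V)"
    using x by (auto simp: K0_class_carrier chi_carrier)
  have "g x \<otimes>\<^bsub>G\<^esub> g (chi V q) = g (chi V p)"
    using chi_mult_K0_class[OF x(1,2)] c x(3) by (metis g.hom_mult)
  moreover have "h x \<otimes>\<^bsub>G\<^esub> h (chi V q) = h (chi V p)"
    using chi_mult_K0_class[OF x(1,2)] c x(3) by (metis h.hom_mult)
  ultimately have "g x \<otimes>\<^bsub>G\<^esub> g (chi V q) = h x \<otimes>\<^bsub>G\<^esub> g (chi V q)"
    using eq x by simp
  then show "g x = h x"
    using c by (simp add: g.H.right_cancel)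
qed

end

section \<open>Functoriality\<close>

locale completely_abs_preserving_map =
  V: absolute_matrix_order_unit_space_T V + W: absolute_matrix_order_unit_space_T W
  for V :: "'v::ab_group_add amou" and W :: "'w::ab_group_add amou" and \<phi> :: "'v \<Rightarrow> 'w" +
  assumes \<phi>: "completely_abs_preserving V W \<phi>"
    and \<phi>_unit: "mat1 (\<phi> (ounit V)) \<in> OP W 1"
begin

abbreviation \<Phi> :: "'v mat \<Rightarrow> 'w mat" where "\<Phi> \<equiv> map_mat \<phi>"

sublocale linear: Vector_Spaces.linear "scl V" "scl W" \<phi>
  using \<phi> by (simp add: completely_abs_preserving_def star_linear_def)

lemma \<Phi>_mats: "v \<in> mats m n \<Longrightarrow> \<Phi> v \<in> mats m n"
  by (simp add: mats_iff)

lemma \<Phi>_dsum: "\<Phi> (dsum v w) = dsum (\<Phi> v) (\<Phi> w)"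
  by (simp add: map_mat_dsum linear.zero)

lemma \<Phi>_mstar: "\<Phi> (mstar V v) = mstar W (\<Phi> v)"
  using \<phi> unfolding completely_abs_preserving_def star_linear_def
  by (intro eq_matI) (auto simp: mstar_def madj_def)

text \<open>The hypothesis concerns square matrices only; the rectangular case follows by applying it to
  the square matrix \<open>dsum v (mstar V v)\<close>.\<close>

lemma mabs_\<Phi>:
  assumes v: "v \<in> mats m n"
  shows "mabs W (\<Phi> v) = \<Phi> (mabs V v)"
proof -
  let ?w = "mstar V v"
  have w: "?w \<in> mats n m" by (rule V.mstar_mats[OF v])
  have "dsum v ?w \<in> mats (m + n) (m + n)" using dsum_mats[OF v w] by (simp add: add.commute)
  then have "mabs W (\<Phi> (dsum v ?w)) = \<Phi> (mabs V (dsum v ?w))"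
    using \<phi> by (auto simp: completely_abs_preserving_def)
  then have eq: "dsum (mabs W (\<Phi> v)) (mabs W (\<Phi> ?w)) = dsum (\<Phi> (mabs V v)) (\<Phi> (mabs V ?w))"
    using W.mabs_dsum[OF \<Phi>_mats \<Phi>_mats, OF v w] V.mabs_dsum[OF v w] by (simp add: \<Phi>_dsum)
  \<comment> \<open>Both top left blocks are \<open>n \<times> n\<close>, so they can be
    compared.\<close>
  have "mabs W (\<Phi> v) \<in> mats n n" "\<Phi> (mabs V v) \<in> mats n n"
    using W.cone_mats[OF W.mabs_pos[OF \<Phi>_mats[OF v]]] V.cone_mats[OF V.mabs_pos[OF v]]
    by (auto intro: \<Phi>_mats)
  then show ?thesis by (intro dsum_left_cancel[OF eq]) (auto simp: mats_iff)
qed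

text \<open>The image of the unit of size \<open>n\<close> is the direct sum of \<open>n\<close>
  copies of the projection \<open>\<phi> (ounit V)\<close>.\<close>

lemma \<Phi>_unitn: "0 < n \<Longrightarrow> \<Phi> (unitn V n) \<in> OP W n"
proof (induction n)
  case (Suc n)
  have one: "\<Phi> (unitn V 1) \<in> OP W 1"
  proof -
    have "\<Phi> (unitn V 1) = mat1 (\<phi> (ounit V))"
      by (rule eq_matI) (auto simp: unitn_def mat1_def)
    then show ?thesis using \<phi>_unit by simp
  qed
  show ?case
  \<comment> \<open>Size 0 is excluded, so the step from 0 to 1 is the true base case.\<close>
  proof (cases "n = 0")
    case False
    with Suc.IH have "dsum (\<Phi> (unitn V n)) (\<Phi> (unitn V 1)) \<in> OP W (n + 1)"
      by (intro W.OP_dsum one) simp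
    moreover have "unitn V (Suc n) = dsum (unitn V n) (unitn V 1)"
      using V.unitn_dsum[of n 1] by simp
    ultimately show ?thesis by (simp add: \<Phi>_dsum)
  qed (use one in simp)
qed simp

lemma \<Phi>_OP:
  assumes p: "p \<in> OP V n"
  shows "\<Phi> p \<in> OP W n"
proof (rule W.relative_projection_OP)
  have n: "0 < n" using p by (simp add: OP_def mats_iff)
  let ?e = "unitn V n"
  have pe: "p \<in> mats n n" "?e \<in> mats n n" using V.OP_mats[OF p] V.unitn_mats[OF n] by auto
  show "\<Phi> p \<in> msa W n"
    using p by (simp add: msa_def OP_def \<Phi>_mats flip: \<Phi>_mstar)
  show "\<Phi> ?e \<in> OP W n" by (rule \<Phi>_unitn[OF n])
  have "\<Phi> p - (\<Phi> ?e - \<Phi> p) = \<Phi> (p - (?e - p))"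
    by (rule eq_matI) (use pe in \<open>auto simp: mats_iff linear.diff\<close>)
  moreover have "p - (?e - p) \<in> mats n n" using pe by (simp add: mats_iff)
  ultimately show "mabs W (\<Phi> p - (\<Phi> ?e - \<Phi> p)) = \<Phi> ?e"
    using mabs_\<Phi> V.OP_relative[OF p] by simp
qed

lemma \<Phi>_OPinf: "p \<in> OPinf V \<Longrightarrow> \<Phi> p \<in> OPinf W"
  by (auto simp: OPinf_def dest: \<Phi>_OP)

lemma \<Phi>_op_equiv:
  assumes "op_equiv V p q"
  shows "op_equiv W (\<Phi> p) (\<Phi> q)"
proof -
  obtain v m n where v: "v \<in> PI V m n" "p = mabs V (mstar V v)" "q = mabs V v"
    using assms by (rule V.op_equivE)
  have vm: "v \<in> mats m n" using v by (simp add: PI_def)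
  have abs: "mabs W (\<Phi> v) = \<Phi> q" "mabs W (mstar W (\<Phi> v)) = \<Phi> p"
    using mabs_\<Phi>[OF vm] mabs_\<Phi>[OF V.mstar_mats[OF vm]] v by (auto simp: \<Phi>_mstar)
  have "\<Phi> v \<in> PI W m n"
    using v vm unfolding PI_def abs mem_Collect_eq by (auto intro: \<Phi>_OP \<Phi>_mats)
  from W.op_equivI[OF this] show ?thesis by (simp add: abs)
qed

lemma \<Phi>_op_stable_equiv: "op_stable_equiv V p q \<Longrightarrow> op_stable_equiv W (\<Phi> p) (\<Phi> q)"
  unfolding op_stable_equiv_def by (metis \<Phi>_OPinf \<Phi>_dsum \<Phi>_op_equiv)

section \<open>The induced homomorphism\<close>

lemma \<Phi>_K0_class:
  assumes "K0_class V p q = K0_class V p' q'"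
    and "p \<in> OPinf V" "q \<in> OPinf V" "p' \<in> OPinf V" "q' \<in> OPinf V"
  shows "K0_class W (\<Phi> p) (\<Phi> q) = K0_class W (\<Phi> p') (\<Phi> q')"
  using assms \<Phi>_op_stable_equiv[of "dsum p q'" "dsum p' q"]
  by (simp add: V.K0_class_eq_iff W.K0_class_eq_iff \<Phi>_OPinf \<Phi>_dsum)

text \<open>The description is meaningful because the image class does not depend on the
  representative chosen; the restriction to the carrier makes the map extensional.\<close>

definition K0_map :: "('v mat \<times> 'v mat) set \<Rightarrow> ('w mat \<times> 'w mat) set" where
  "K0_map = (\<lambda>A\<in>carrier (K0 V). THE B. \<exists>p\<in>OPinf V. \<exists>q\<in>OPinf V.
     A = K0_class V p q \<and> B = K0_class W (\<Phi> p) (\<Phi> q))"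

lemma K0_map_class:
  assumes "p \<in> OPinf V" "q \<in> OPinf V"
  shows "K0_map (K0_class V p q) = K0_class W (\<Phi> p) (\<Phi> q)"
proof -
  have "(THE B. \<exists>p'\<in>OPinf V. \<exists>q'\<in>OPinf V.
      K0_class V p q = K0_class V p' q' \<and> B = K0_class W (\<Phi> p') (\<Phi> q'))
      = K0_class W (\<Phi> p) (\<Phi> q)"
    using assms by (intro the_equality) (auto dest: \<Phi>_K0_class)
  then show ?thesis using assms by (simp add: K0_map_def V.K0_class_carrier)
qed

lemma K0_map_chi: "p \<in> OPinf V \<Longrightarrow> K0_map (chi V p) = chi W (\<Phi> p)"
proof -
  have "\<Phi> (0\<^sub>m 1 1) = 0\<^sub>m 1 1" by (rule eq_matI) (auto simp: linear.zero)
  then show "p \<in> OPinf V \<Longrightarrow> K0_map (chi V p) = chi W (\<Phi> p)"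
    using V.zero_OPinf by (simp add: chi_def K0_map_class)
qed

lemma K0_map_hom: "group_hom (K0 V) (K0 W) K0_map"
proof (intro group_hom.intro group_hom_axioms.intro homI)
  show "group (K0 V)" "group (K0 W)"
    using V.comm_group_K0 W.comm_group_K0 by (auto simp: comm_group_def)
qed (auto simp: V.carrier_K0_iff K0_map_class V.K0_mult W.K0_mult V.OPinf_dsum \<Phi>_OPinf \<Phi>_dsum
    intro!: W.K0_class_carrier)

end

text \<open>Functions are total here, so uniqueness is stated among maps with a fixed value outside
  the carrier. \<open>group_hom\<close> also asserts that source and target are groups.\<close>

theorem theorem5p2:
  fixes V :: "'v::ab_group_add amou"
    and W :: "'w::ab_group_add amou"
    and \<phi> :: "'v \<Rightarrow> 'w"
  assumes "absolute_matrix_order_unit_space V"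
    and "absolute_matrix_order_unit_space W"
    and "condition_T V"
    and "condition_T W"
    and "completely_abs_preserving V W \<phi>"
    and "mat1 (\<phi> (ounit V)) \<in> OP W 1"
  shows "map_mat \<phi> ` OPinf V \<subseteq> OPinf W \<and>
    (\<exists>!h. group_hom (K0 V) (K0 W) h \<and> h \<in> extensional (carrier (K0 V)) \<and>
          (\<forall>p\<in>OPinf V. h (chi V p) = chi W (map_mat \<phi> p)))"
proof -
  interpret completely_abs_preserving_map V W \<phi>
    using assms
    by (simp add: completely_abs_preserving_map_def completely_abs_preserving_map_axioms_def
        absolute_matrix_order_unit_space_T_def absolute_matrix_order_unit_space_T_axioms_def)
  have "K0_map \<in> extensional (carrier (K0 V))" by (simp add: K0_map_def)
  then have "\<exists>!h. group_hom (K0 V) (K0 W) h \<and> h \<in> extensional (carrier (K0 V)) \<and>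
      (\<forall>p\<in>OPinf V. h (chi V p) = chi W (map_mat \<phi> p))"
    by (intro ex1I[of _ K0_map] conjI)
      (auto simp: K0_map_hom K0_map_chi intro!: V.K0_hom_eqI)
  then show ?thesis using \<Phi>_OPinf by blast
qed

end
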